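(* Let $F(w)=\mathbb{E}[f(w;\xi)]$, $w\in\mathbb{R}^d$. Assume $F$ is $\mu$-strongly convex for some $\mu>0$ and that for every realization of $\xi$ the function $f(\cdot;\xi)$ is $L$-smooth with a common constant $L>0$ (but not necessarily convex). Let $\kappa=\frac{L}{\mu}$, $w_*=\arg\min_wF(w)$ and $N=2\,\mathbb{E}[\|\nabla f(w_*;\xi)\|^2]$. Then for all $w\in\mathbb{R}^d$, $$\mathbb{E}[\|\nabla f(w;\xi)\|^2]\le 4L\kappa\,[F(w)-F(w_* )]+N .$$
   Context: $\xi$ is a random variable, $f(\cdot;\xi):\mathbb{R}^d\to\mathbb{R}$ is differentiable for each realization of $\xi$, and $\mathbb{E}[\nabla f(w;\xi)]=\nabla F(w)$ for every fixed $w$. $\|\cdot\|$ is the Euclidean norm. $\mu$-strongly convex: $F(w)-F(w')\ge\langle\nabla F(w'),w-w'\rangle+\frac{\mu}{2}\|w-w'\|^2$ for all $w,w'\in\mathbb{R}^d$. $L$-smooth: $\|\nabla f(w;\xi)-\nabla f(w';\xi)\|\le L\|w-w'\|$ for all $w,w'\in\mathbb{R}^d$. *)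

theory Defs
  imports "HOL-Probability.Probability"
begin

definition gradient :: "('a::real_inner \<Rightarrow> real) \<Rightarrow> 'a \<Rightarrow> 'a" where
  "gradient g x = (THE D. GDERIV g x :> D)"

lemma gradient_eqI:
  assumes "GDERIV g x :> D"
  shows "gradient g x = D"
  unfolding gradient_def
proof (rule the_equality)
  fix D' assume "GDERIV g x :> D'"
  with assms have "(\<lambda>h. inner h D') = (\<lambda>h. inner h D)"
    unfolding gderiv_def by (rule has_derivative_unique[rotated])
  then have "inner h (D' - D) = 0" for h
    by (simp add: inner_diff_right fun_eq_iff)
  from this[of "D' - D"] show "D' = D" by simp
qed (fact assms)

lemma GDERIV_gradient:
  fixes g :: "'a::euclidean_space \<Rightarrow> real"
  assumes "g differentiable (at x)"
  shows "GDERIV g x :> gradient g x"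
proof -
  obtain g' where g': "(g has_derivative g') (at x)"
    using assms unfolding differentiable_def by blast
  have "g' = (\<lambda>h. inner h (adjoint g' 1))"
    using adjoint_works[OF has_derivative_linear[OF g'], of _ 1]
    by (simp add: fun_eq_iff)
  with g' have "GDERIV g x :> adjoint g' 1"
    unfolding gderiv_def by simp
  then show ?thesis by (simp add: gradient_eqI)
qed

definition strongly_convex :: "real \<Rightarrow> ('a::real_inner \<Rightarrow> real) \<Rightarrow> bool" where
  "strongly_convex \<mu> G \<longleftrightarrow>
     (\<forall>w w'. G w - G w' \<ge> inner (gradient G w') (w - w') + \<mu> / 2 * (norm (w - w'))\<^sup>2)"

definition L_smooth :: "real \<Rightarrow> ('a::real_inner \<Rightarrow> real) \<Rightarrow> bool" where
  "L_smooth L g \<longleftrightarrow>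
     (\<forall>w w'. norm (gradient g w - gradient g w') \<le> L * norm (w - w'))"

end

theory Submission
  imports Defs
begin

text \<open>
  Split the gradient at \<open>w\<close> around the gradient at the minimizer with
  \<open>\<parallel>a\<parallel>\<^sup>2 \<le> 2\<parallel>a - b\<parallel>\<^sup>2 + 2\<parallel>b\<parallel>\<^sup>2\<close>. Smoothness bounds the difference by \<open>L\<parallel>w - w_star\<parallel>\<close>, and
  strong convexity at the stationary point \<open>w_star\<close> bounds the squared distance by
  \<open>2 / \<mu>\<close> times the optimality gap. Strong convexity also makes \<open>F\<close> coercive, so that the
  \<open>arg_min\<close>, a choice operator, does pick out a minimizer.
\<close>

text \<open>The closed ball is compact and contains 0, so the minimum of \<open>G\<close> over it is
  at most \<open>G 0\<close>, which in turn bounds every value outside from below.\<close>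

lemma attains_inf_of_ge_outside_cball:
  fixes G :: "'a::euclidean_space \<Rightarrow> real"
  assumes cont: "continuous_on UNIV G" and "0 \<le> r"
    and outside: "\<And>w. norm w > r \<Longrightarrow> G 0 \<le> G w"
  shows "\<exists>m. \<forall>w. G m \<le> G w"
proof -
  have "\<exists>m\<in>cball 0 r. \<forall>w\<in>cball 0 r. G m \<le> G w"
    using \<open>0 \<le> r\<close> cont
    by (intro continuous_attains_inf) (auto intro: continuous_on_subset)
  then obtain m where m: "\<And>w. w \<in> cball 0 r \<Longrightarrow> G m \<le> G w"
    by blast
  have "G m \<le> G w" for w
    using m[of w] m[of 0] outside[of w] \<open>0 \<le> r\<close> by force
  then show ?thesis by blast
qed

lemma strongly_convex_attains_inf:
  fixes G :: "'a::euclidean_space \<Rightarrow> real"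
  assumes cont: "continuous_on UNIV G" and sc: "strongly_convex \<mu> G" and "\<mu> > 0"
  shows "\<exists>m. \<forall>w. G m \<le> G w"
proof (rule attains_inf_of_ge_outside_cball[OF cont])
  let ?g = "gradient G 0"
  \<comment> \<open>Beyond this radius the quadratic term of strong convexity at 0 dominates the
    linear term, which Cauchy-Schwarz bounds below by \<open>- (norm ?g * norm w)\<close>.\<close>
  show "0 \<le> 2 * norm ?g / \<mu>" using \<open>\<mu> > 0\<close> by simp
  fix w :: 'a
  assume "2 * norm ?g / \<mu> < norm w"
  then have "2 * norm ?g \<le> \<mu> * norm w"
    using \<open>\<mu> > 0\<close> by (simp add: field_simps)
  then have "2 * norm ?g * norm w \<le> \<mu> * norm w * norm w"
    by (rule mult_right_mono) simp
  moreover have "- (norm ?g * norm w) \<le> inner ?g w"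
    using Cauchy_Schwarz_ineq2[of ?g w] by linarith
  moreover have "inner ?g (w - 0) + \<mu> / 2 * (norm (w - 0))\<^sup>2 \<le> G w - G 0"
    using sc unfolding strongly_convex_def by blast
  ultimately show "G 0 \<le> G w"
    by (simp add: power2_eq_square)
qed

lemma gradient_eq_0_at_min:
  fixes G :: "'a::euclidean_space \<Rightarrow> real"
  assumes "G differentiable (at m)" and min: "\<And>w. G m \<le> G w"
  shows "gradient G m = 0"
proof -
  have "(G has_derivative (\<lambda>h. inner h (gradient G m))) (at m)"
    using GDERIV_gradient[OF assms(1)] unfolding gderiv_def .
  then have "(\<lambda>h. inner h (gradient G m)) = (\<lambda>h. 0)"
    by (rule has_derivative_local_min) (simp add: min)
  \<comment> \<open>The vanishing derivative is evaluated in the direction of the gradient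
    itself.\<close>
  then have "inner (gradient G m) (gradient G m) = 0" by (rule fun_cong)
  then show ?thesis by simp
qed

lemma strongly_convex_quadratic_growth:
  fixes G :: "'a::euclidean_space \<Rightarrow> real"
  assumes "G differentiable (at m)" and "\<And>w. G m \<le> G w" and "strongly_convex \<mu> G"
  shows "\<mu> / 2 * (norm (w - m))\<^sup>2 \<le> G w - G m"
proof -
  have "inner (gradient G m) (w - m) + \<mu> / 2 * (norm (w - m))\<^sup>2 \<le> G w - G m"
    using assms(3) unfolding strongly_convex_def by blast
  then show ?thesis by (simp add: gradient_eq_0_at_min[OF assms(1,2)])
qed

text \<open>Parallelogram law for \<open>a - b\<close> and \<open>b\<close>: the slack in the
  inequality is exactly the square of \<open>norm (a - 2 *\<^sub>R b)\<close>.\<close>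

lemma norm_power2_le_twice_diff:
  fixes a b :: "'a::real_inner"
  shows "(norm a)\<^sup>2 \<le> 2 * (norm (a - b))\<^sup>2 + 2 * (norm b)\<^sup>2"
proof -
  have "2 * (norm (a - b))\<^sup>2 + 2 * (norm b)\<^sup>2 - (norm a)\<^sup>2 = (norm (a - 2 *\<^sub>R b))\<^sup>2"
    by (simp add: power2_norm_eq_inner algebra_simps inner_commute)
  then show ?thesis by (smt (verit) zero_le_power2)
qed

theorem lemma2:
  fixes M :: "'o measure" and S :: "'s measure" and \<xi> :: "'o \<Rightarrow> 's"
    and f :: "real ^ 'd \<Rightarrow> 's \<Rightarrow> real"
    and F :: "real ^ 'd \<Rightarrow> real" and w_star :: "real ^ 'd"
    and \<mu> L \<kappa> :: real and N :: ennreal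
  assumes "prob_space M" and "\<xi> \<in> measurable M S"
    and f_diff: "\<And>\<omega> w. \<omega> \<in> space M \<Longrightarrow> (\<lambda>v. f v (\<xi> \<omega>)) differentiable (at w)"
    and f_int: "\<And>w. integrable M (\<lambda>\<omega>. f w (\<xi> \<omega>))"
    and F_eq: "F = (\<lambda>w. \<integral>\<omega>. f w (\<xi> \<omega>) \<partial>M)"
    and F_diff: "\<And>w. F differentiable (at w)"
    and grad_int: "\<And>w. integrable M (\<lambda>\<omega>. gradient (\<lambda>v. f v (\<xi> \<omega>)) w)"
    and grad_unbiased: "\<And>w. (\<integral>\<omega>. gradient (\<lambda>v. f v (\<xi> \<omega>)) w \<partial>M) = gradient F w"
    and "\<mu> > 0" and "strongly_convex \<mu> F"
    and "L > 0" and smooth: "\<And>\<omega>. \<omega> \<in> space M \<Longrightarrow> L_smooth L (\<lambda>v. f v (\<xi> \<omega>))"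
    and kappa_eq: "\<kappa> = L / \<mu>"
    and w_star_eq: "w_star = arg_min F (\<lambda>_. True)"
    and N_eq: "N = 2 * (\<integral>\<^sup>+\<omega>. ennreal ((norm (gradient (\<lambda>v. f v (\<xi> \<omega>)) w_star))\<^sup>2) \<partial>M)"
  shows "\<forall>w. (\<integral>\<^sup>+\<omega>. ennreal ((norm (gradient (\<lambda>v. f v (\<xi> \<omega>)) w))\<^sup>2) \<partial>M)
               \<le> ennreal (4 * L * \<kappa> * (F w - F w_star)) + N"
proof
  fix w
  let ?g = "\<lambda>v \<omega>. gradient (\<lambda>u. f u (\<xi> \<omega>)) v"
  let ?c = "4 * L * \<kappa> * (F w - F w_star)"
  interpret prob_space M by fact
  have "continuous_on UNIV F"
    using F_diff by (simp add: differentiable_imp_continuous_on differentiable_on_def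
        differentiable_at_withinI)
  from strongly_convex_attains_inf[OF this \<open>strongly_convex \<mu> F\<close> \<open>\<mu> > 0\<close>]
  have "\<exists>m. is_arg_min F (\<lambda>_. True) m"
    by (simp add: is_arg_min_linorder)
  then have "is_arg_min F (\<lambda>_. True) w_star"
    unfolding w_star_eq arg_min_def by (rule someI_ex)
  then have min: "F w_star \<le> F v" for v
    by (simp add: is_arg_min_linorder)
  have growth: "\<mu> / 2 * (norm (w - w_star))\<^sup>2 \<le> F w - F w_star"
    using F_diff min \<open>strongly_convex \<mu> F\<close> by (rule strongly_convex_quadratic_growth)
  \<comment> \<open>Since \<open>ennreal\<close> sends negative reals to 0, this sign is what allows
    \<open>ennreal\<close> to be distributed over the sum below.\<close>
  have "0 \<le> ?c"
    using min[of w] \<open>L > 0\<close> \<open>\<mu> > 0\<close> by (simp add: kappa_eq)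
  have pointwise: "(norm (?g w \<omega>))\<^sup>2 \<le> ?c + 2 * (norm (?g w_star \<omega>))\<^sup>2"
    if "\<omega> \<in> space M" for \<omega>
  proof -
    have "norm (?g w \<omega> - ?g w_star \<omega>) \<le> L * norm (w - w_star)"
      using smooth[OF that] unfolding L_smooth_def by blast
    then have "2 * (norm (?g w \<omega> - ?g w_star \<omega>))\<^sup>2 \<le> 2 * (L * norm (w - w_star))\<^sup>2"
      by (simp add: power_mono)
    \<comment> \<open>The constant arises from \<open>L = \<kappa> * \<mu>\<close>: the factor
      \<open>2 * L\<^sup>2\<close> equals \<open>4 * L * \<kappa>\<close> times the growth constant
      \<open>\<mu> / 2\<close>.\<close>
    also have "\<dots> = 4 * L * \<kappa> * (\<mu> / 2 * (norm (w - w_star))\<^sup>2)"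
      using \<open>\<mu> > 0\<close> by (simp add: kappa_eq power2_eq_square)
    also have "\<dots> \<le> ?c"
      using growth \<open>L > 0\<close> \<open>\<mu> > 0\<close> by (intro mult_left_mono) (auto simp: kappa_eq)
    finally show ?thesis
      using norm_power2_le_twice_diff[of "?g w \<omega>" "?g w_star \<omega>"] by linarith
  qed
  \<comment> \<open>Measurability at \<open>w_star\<close> lets the integral of the upper bound be
    split into its two terms.\<close>
  have [measurable]: "?g w_star \<in> borel_measurable M"
    using grad_int by (rule borel_measurable_integrable)
  have "(\<integral>\<^sup>+\<omega>. ennreal ((norm (?g w \<omega>))\<^sup>2) \<partial>M)
      \<le> (\<integral>\<^sup>+\<omega>. ennreal ?c + 2 * ennreal ((norm (?g w_star \<omega>))\<^sup>2) \<partial>M)"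
  proof (rule nn_integral_mono)
    fix \<omega> assume "\<omega> \<in> space M"
    then have "ennreal ((norm (?g w \<omega>))\<^sup>2) \<le> ennreal (?c + 2 * (norm (?g w_star \<omega>))\<^sup>2)"
      by (intro ennreal_leI pointwise)
    also have "\<dots> = ennreal ?c + 2 * ennreal ((norm (?g w_star \<omega>))\<^sup>2)"
      using \<open>0 \<le> ?c\<close> by (simp add: ennreal_plus ennreal_mult)
    finally show "ennreal ((norm (?g w \<omega>))\<^sup>2) \<le> \<dots>" .
  qed
  \<comment> \<open>The constant integrates to itself because \<open>M\<close> has total mass 1. The
    computation stays in \<open>ennreal\<close>, so it also covers an infinite
    \<open>N\<close>.\<close>
  also have "\<dots> = ennreal ?c + N"
    by (simp add: nn_integral_add nn_integral_cmult emeasure_space_1 N_eq)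
  finally show "(\<integral>\<^sup>+\<omega>. ennreal ((norm (?g w \<omega>))\<^sup>2) \<partial>M) \<le> ennreal ?c + N" .
qed

end
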